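(* Consider the disturbance-free closed loop $x(k+1)=f(x(k),u(k),\mathbf{0}_m)$, $k\in\mathbb{N}_0$, with $u(k)$ generated by Algorithm A$_1$ (described in the context). Suppose that: (1) there exist $\varphi_1,\varphi_2\in\mathscr{K}_\infty$, $V\colon\mathbb{R}^n\to\mathbb{R}_{\ge 0}$, $\kappa\colon\mathbb{R}^n\to\mathbb{R}^p$ and $\rho\in[0,1)$ such that for all $x\in\mathbb{R}^n$, $\varphi_1(|x|)\le V(x)\le\varphi_2(|x|)$ and $V(f(x,\kappa(x),\mathbf{0}_m))\le\rho V(x)$; (2) the process $\{N(k)\}_{k\in\mathbb{N}_0}$ is i.i.d. with $\Pr\{N(k)=l\}=p_l$, $l\in\{0,1,\dots,\Lambda\}$, and $p_0\in[0,1)$; (3) there exists $\alpha\in[1,1/p_0)$ such that $V(f(x,\mathbf{0}_p,\mathbf{0}_m))\le\alpha V(x)$ for all $x\in\mathbb{R}^n$, and $\mathbf{E}\{\varphi_2(|x(0)|)\}<\infty$. Define $$\sigma=\frac{1}{1-p_0\rho}\Big(\rho(1-p_0\alpha)+\frac{\alpha-\rho}{1-p_0}\sum_{l=1}^{\Lambda}p_l(p_0\rho)^l\Big).$$ If $p_0\alpha+(1-p_0)\sigma<1$, then the closed loop with state trajectory $\{x(k)\}_{k\in\mathbb{N}_0}$ is stochastically stable.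
   Context: Notation: $\mathbb{N}=\{1,2,\dots\}$, $\mathbb{N}_0=\mathbb{N}\cup\{0\}$; $\mathbf{0}_q$ is the zero vector in $\mathbb{R}^q$; $|\cdot|$ is the Euclidean norm; $1/p_0=\infty$ if $p_0=0$. A function $\varphi\colon\mathbb{R}_{\ge0}\to\mathbb{R}_{\ge0}$ is in $\mathscr{K}_\infty$ if it is continuous, zero at zero, strictly increasing and unbounded. Plant: $f\colon\mathbb{R}^n\times\mathbb{R}^p\times\mathbb{R}^m\to\mathbb{R}^n$ with $f(\mathbf{0}_n,\mathbf{0}_p,\mathbf{0}_m)=\mathbf{0}_n$; the initial state $x(0)$ is random. Stochastic stability: a system with state trajectory $\{x(k)\}_{k\in\mathbb{N}_0}$ is stochastically stable if $\sum_{k=0}^\infty\mathbf{E}\{\varphi(|x(k)|)\}<\infty$ for some $\varphi\in\mathscr{K}_\infty$. Algorithm A$_1$: $\Lambda\in\mathbb{N}$ is the buffer size, and $N(k)\in\{0,1,\dots,\Lambda\}$ is the random number of tentative controls that the processor can compute at step $k$. The tentative controls are computed by a fixed rule $\mu\colon\mathbb{R}^n\to\mathbb{R}^p$ satisfying $V(f(\chi,\mu(\chi),\mathbf{0}_m))\le\rho V(\chi)$ for all $\chi$ (for example $\mu=\kappa$): if $N(k)\ge1$, put $\chi_1=x(k)$ and, for $j=1,\dots,N(k)$, $u_j(k)=\mu(\chi_j)$, $\chi_{j+1}=f(\chi_j,u_j(k),\mathbf{0}_m)$. The buffer $b(k)=(b_1(k),\dots,b_\Lambda(k))$, with $b_j(k)\in\mathbb{R}^p$,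 is initialized by $b(-1)=0$ and obeys: if $N(k)=0$, $b(k)=(b_2(k-1),\dots,b_\Lambda(k-1),\mathbf{0}_p)$; if $N(k)\ge1$, $b(k)=(u_1(k),\dots,u_{N(k)}(k),\mathbf{0}_p,\dots,\mathbf{0}_p)$. The plant input is $u(k)=b_1(k)$. Standing conventions: it is assumed that $N(0)>0$ (probabilities and expectations are understood conditionally on this event); $x(0)$ is independent of $\{N(k)\}$; and $f,V,\kappa,\mu$ are Borel measurable. *)

theory Defs
  imports "HOL-Probability.Probability"
begin

text \<open>Functions on the nonnegative reals are represented by functions on all reals whose
  values at negative arguments are irrelevant. Nonnegativity on \<open>{0..}\<close> follows from
  \<open>\<phi> 0 = 0\<close> and strict monotonicity.\<close>

definition class_K_infinity :: "(real \<Rightarrow> real) \<Rightarrow> bool" where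
  "class_K_infinity \<phi> \<longleftrightarrow>
     continuous_on {0..} \<phi> \<and> \<phi> 0 = 0 \<and> strict_mono_on {0..} \<phi> \<and> \<not> bdd_above (\<phi> ` {0..})"

definition stochastically_stable ::
    "'w measure \<Rightarrow> (nat \<Rightarrow> 'w \<Rightarrow> 'a::real_normed_vector) \<Rightarrow> bool" where
  "stochastically_stable P x \<longleftrightarrow>
     (\<exists>\<phi>. class_K_infinity \<phi> \<and> (\<Sum>k. \<integral>\<^sup>+\<omega>. ennreal (\<phi> (norm (x k \<omega>))) \<partial>P) < \<infinity>)"

type_synonym ('n, 'p, 'm) plant = "(real^'n) \<times> (real^'p) \<times> (real^'m) \<Rightarrow> real^'n"

text \<open>Indices of tentative controls start at 1: \<open>tentative_control f \<mu> z j\<close> is \<open>\<mu>\<close> applied to the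
  disturbance-free prediction made \<open>j - 1\<close> steps ahead of \<open>z\<close>.\<close>

definition tentative_control ::
    "('n::finite, 'p::finite, 'm::finite) plant \<Rightarrow> (real^'n \<Rightarrow> real^'p) \<Rightarrow> real^'n \<Rightarrow> nat \<Rightarrow> real^'p" where
  "tentative_control f \<mu> z j = \<mu> (((\<lambda>y. f (y, \<mu> y, 0)) ^^ (j - 1)) z)"

text \<open>A buffer is a list of length \<open>\<Lambda>\<close>; its head is the entry \<open>b\<^sub>1\<close> applied to the plant.
  The argument \<open>l\<close> is the number of tentative controls computed in the current step.\<close>

definition update_buffer ::
    "('n::finite, 'p::finite, 'm::finite) plant \<Rightarrow> (real^'n \<Rightarrow> real^'p) \<Rightarrow> nat \<Rightarrow> nat \<Rightarrow> real^'n
      \<Rightarrow> (real^'p) list \<Rightarrow> (real^'p) list" where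
  "update_buffer f \<mu> \<Lambda> l z b =
     (if l = 0 then tl b @ [0]
      else map (tentative_control f \<mu> z) [1..<l + 1] @ replicate (\<Lambda> - l) 0)"

text \<open>Closed loop along one realization: \<open>\<xi>\<close> is the initial state and \<open>\<nu> k\<close> the number of
  controls computed at step \<open>k\<close>. The list \<open>replicate \<Lambda> 0\<close> is the buffer at time \<open>-1\<close>.\<close>

fun loop_state ::
    "('n::finite, 'p::finite, 'm::finite) plant \<Rightarrow> (real^'n \<Rightarrow> real^'p) \<Rightarrow> nat \<Rightarrow> real^'n
      \<Rightarrow> (nat \<Rightarrow> nat) \<Rightarrow> nat \<Rightarrow> real^'n"
and loop_buffer ::
    "('n::finite, 'p::finite, 'm::finite) plant \<Rightarrow> (real^'n \<Rightarrow> real^'p) \<Rightarrow> nat \<Rightarrow> real^'n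
      \<Rightarrow> (nat \<Rightarrow> nat) \<Rightarrow> nat \<Rightarrow> (real^'p) list" where
  "loop_state f \<mu> \<Lambda> \<xi> \<nu> 0 = \<xi>"
| "loop_state f \<mu> \<Lambda> \<xi> \<nu> (Suc k) =
     f (loop_state f \<mu> \<Lambda> \<xi> \<nu> k, hd (loop_buffer f \<mu> \<Lambda> \<xi> \<nu> k), 0)"
| "loop_buffer f \<mu> \<Lambda> \<xi> \<nu> 0 =
     update_buffer f \<mu> \<Lambda> (\<nu> 0) (loop_state f \<mu> \<Lambda> \<xi> \<nu> 0) (replicate \<Lambda> 0)"
| "loop_buffer f \<mu> \<Lambda> \<xi> \<nu> (Suc k) =
     update_buffer f \<mu> \<Lambda> (\<nu> (Suc k)) (loop_state f \<mu> \<Lambda> \<xi> \<nu> (Suc k)) (loop_buffer f \<mu> \<Lambda> \<xi> \<nu> k)"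

end

theory Submission
  imports Defs
begin

text \<open>The disturbance-free predictions are exact, so after step \<open>k\<close> the buffer holds the controls
  that would be computed afresh from the current state, followed by zeros. How many of its entries
  are genuine controls depends on the computing resources alone: a step with \<open>l \<ge> 1\<close> resets this
  number to \<open>l\<close>, and a step with \<open>l = 0\<close> lowers it by one unless it is 0. If it is positive, \<open>V\<close> is multiplied by at
  most \<open>\<rho>\<close> in this step, otherwise by at most \<open>\<alpha>\<close>. Hence \<open>V (x k) \<le> V (x 0) * G k\<close>, where the
  \<open>gain\<close> \<open>G k\<close> is a product of factors \<open>\<rho>\<close> and \<open>\<alpha>\<close> driven by \<open>N\<close>
  (\<open>lyapunov_le_gain\<close>). As \<open>N\<close> and \<open>x 0\<close> are independent and \<open>\<phi>1 (norm z) \<le> V z \<le> \<phi>2 (norm z)\<close>, it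
  suffices, with \<open>\<phi>1\<close> as the function that witnesses stability, that the expected total gain
  \<open>E (G 0) + E (G 1) + \<dots>\<close> is finite.

  The number of genuine controls is a Markov chain. Suppose that \<open>h \<ge> 0\<close> satisfies
  \<open>h j = 1 + E (r j' * h j')\<close>, where \<open>j'\<close> is the successor of \<open>j\<close> and \<open>r j'\<close> the factor incurred in
  it. Then \<open>E (G k) + E (G (k + 1) * h j\<^sub>k\<^sub>+\<^sub>1) = E (G k * h j\<^sub>k)\<close>, and telescoping bounds the total
  expected gain by \<open>h 0\<close> (\<open>expected_total_gain_le\<close>).

  Such an \<open>h\<close> is found by splitting at the first step that computes a control
  (\<open>potential_exists\<close>). Let \<open>t j\<close> be the expected sum of the gains up to and including the one with
  which that step begins, so that \<open>t j = 1 + p 0 * r (j - 1) * t (j - 1)\<close> with truncated subtraction.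
  Each such step with \<open>l\<close> controls starts the same process anew with weight \<open>\<rho> * t l\<close>, so the total
  is a geometric series with ratio \<open>\<theta> = (\<Sum>l = 1..\<Lambda>. p l * \<rho> * t l)\<close>. Evaluating \<open>t\<close> shows that
  \<open>(1 - p 0) * \<sigma> = (1 - p 0 * \<alpha>) * \<theta>\<close>; the stability condition says exactly that \<open>\<theta> < 1\<close>.\<close>

section \<open>Number of usable controls in the buffer\<close>

definition next_count :: "nat \<Rightarrow> nat \<Rightarrow> nat" where
  "next_count j l = (if l = 0 then j - 1 else l)"

text \<open>The value at \<open>k\<close> refers to the buffer left over from step \<open>k - 1\<close>, so that it depends only
  on \<open>\<nu> 0, \<dots>, \<nu> (k - 1)\<close> and is independent of the computing resources at step \<open>k\<close>.\<close>

primrec usable_before :: "(nat \<Rightarrow> nat) \<Rightarrow> nat \<Rightarrow> nat" where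
  "usable_before \<nu> 0 = 0"
| "usable_before \<nu> (Suc k) = next_count (usable_before \<nu> k) (\<nu> k)"

definition rate :: "real \<Rightarrow> real \<Rightarrow> nat \<Rightarrow> real" where
  "rate \<rho> \<alpha> j = (if j = 0 then \<alpha> else \<rho>)"

definition gain :: "real \<Rightarrow> real \<Rightarrow> (nat \<Rightarrow> nat) \<Rightarrow> nat \<Rightarrow> real" where
  "gain \<rho> \<alpha> \<nu> k = (\<Prod>i<k. rate \<rho> \<alpha> (usable_before \<nu> (Suc i)))"

lemma gain_0: "gain \<rho> \<alpha> \<nu> 0 = 1"
  by (simp add: gain_def)

lemma gain_Suc:
  "gain \<rho> \<alpha> \<nu> (Suc k) = gain \<rho> \<alpha> \<nu> k * rate \<rho> \<alpha> (next_count (usable_before \<nu> k) (\<nu> k))"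
  by (simp add: gain_def)

lemma rate_nonneg: "0 \<le> \<rho> \<Longrightarrow> 0 \<le> \<alpha> \<Longrightarrow> 0 \<le> rate \<rho> \<alpha> j"
  by (simp add: rate_def)

lemma gain_nonneg: "0 \<le> \<rho> \<Longrightarrow> 0 \<le> \<alpha> \<Longrightarrow> 0 \<le> gain \<rho> \<alpha> \<nu> k"
  by (simp add: gain_def prod_nonneg rate_nonneg)

lemma usable_before_cong: "(\<And>i. i < k \<Longrightarrow> \<nu> i = \<nu>' i) \<Longrightarrow> usable_before \<nu> k = usable_before \<nu>' k"
  by (induction k) auto

lemma gain_cong: "(\<And>i. i < k \<Longrightarrow> \<nu> i = \<nu>' i) \<Longrightarrow> gain \<rho> \<alpha> \<nu> k = gain \<rho> \<alpha> \<nu>' k"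
  unfolding gain_def
  by (intro prod.cong refl arg_cong[where f = "rate \<rho> \<alpha>"] usable_before_cong) auto

lemma usable_before_le: "(\<And>i. \<nu> i \<le> \<Lambda>) \<Longrightarrow> usable_before \<nu> k \<le> \<Lambda>"
  by (induction k) (auto simp: next_count_def intro: le_trans[OF diff_le_self])

section \<open>Growth of the Lyapunov function along one realization\<close>

definition planned_buffer ::
    "('n::finite, 'p::finite, 'm::finite) plant \<Rightarrow> (real^'n \<Rightarrow> real^'p) \<Rightarrow> nat \<Rightarrow> real^'n \<Rightarrow> nat
      \<Rightarrow> (real^'p) list" where
  "planned_buffer f \<mu> \<Lambda> z j = map (tentative_control f \<mu> z) [1..<j + 1] @ replicate (\<Lambda> - j) 0"

lemma tentative_control_Suc:
  "tentative_control f \<mu> z (Suc (Suc j)) = tentative_control f \<mu> (f (z, \<mu> z, 0)) (Suc j)"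
  using funpow_swap1[of "\<lambda>y. f (y, \<mu> y, 0)" j z] by (simp add: tentative_control_def)

lemma planned_buffer_Suc:
  "planned_buffer f \<mu> \<Lambda> z (Suc j) =
     \<mu> z # map (tentative_control f \<mu> (f (z, \<mu> z, 0))) [1..<j + 1] @ replicate (\<Lambda> - Suc j) 0"
proof -
  have "map (tentative_control f \<mu> z) [1..<Suc j + 1] =
      tentative_control f \<mu> z 1 # map (\<lambda>i. tentative_control f \<mu> z (Suc i)) [1..<j + 1]"
    by (simp add: upt_conv_Cons map_Suc_upt[symmetric] del: upt_Suc)
  also have "map (\<lambda>i. tentative_control f \<mu> z (Suc i)) [1..<j + 1] =
      map (tentative_control f \<mu> (f (z, \<mu> z, 0))) [1..<j + 1]"
  proof (rule map_cong)
    fix i assume "i \<in> set [1..<j + 1]"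
    then have "1 \<le> i" by (simp del: upt_Suc)
    then obtain i' where "i = Suc i'" by (cases i) auto
    then show "tentative_control f \<mu> z (Suc i) = tentative_control f \<mu> (f (z, \<mu> z, 0)) i"
      by (simp add: tentative_control_Suc)
  qed simp
  finally show ?thesis
    unfolding planned_buffer_def by (simp add: tentative_control_def[of f \<mu> z 1, simplified] del: upt_Suc)
qed

lemma hd_planned_buffer:
  assumes "1 \<le> \<Lambda>"
  shows "hd (planned_buffer f \<mu> \<Lambda> z j) = (if j = 0 then 0 else \<mu> z)"
proof (cases j)
  case 0
  then show ?thesis using assms by (cases \<Lambda>) (auto simp: planned_buffer_def)
next
  case (Suc i)
  then show ?thesis by (simp only: planned_buffer_Suc) simp
qed

text \<open>Without disturbances the predictions are exact: the controls that are left over from an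
  earlier step are the ones that would be computed afresh from the current state. Hence shifting
  the buffer keeps it of planned form.\<close>

lemma update_planned_buffer:
  fixes f :: "('n::finite, 'p::finite, 'm::finite) plant"
  assumes "1 \<le> \<Lambda>" "j \<le> \<Lambda>" "l \<le> \<Lambda>"
  shows "update_buffer f \<mu> \<Lambda> l (f (z, hd (planned_buffer f \<mu> \<Lambda> z j), 0)) (planned_buffer f \<mu> \<Lambda> z j)
       = planned_buffer f \<mu> \<Lambda> (f (z, hd (planned_buffer f \<mu> \<Lambda> z j), 0)) (next_count j l)"
proof (cases "l = 0")
  case True
  show ?thesis
  proof (cases j)
    case 0
    then show ?thesis using True assms
      by (cases \<Lambda>) (auto simp: update_buffer_def planned_buffer_def next_count_def replicate_append_same)
  next
    case (Suc i)
    have "\<Lambda> - i = Suc (\<Lambda> - Suc i)" using assms Suc by auto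
    then have "replicate (\<Lambda> - Suc i) 0 @ [0 :: real^'p] = replicate (\<Lambda> - i) 0"
      by (simp add: replicate_append_same)
    then show ?thesis using True Suc
      by (simp add: update_buffer_def next_count_def planned_buffer_Suc del: upt_Suc)
        (simp add: planned_buffer_def)
  qed
next
  case False
  then show ?thesis
    by (simp add: update_buffer_def planned_buffer_def next_count_def)
qed

lemma loop_buffer_eq_planned:
  assumes "1 \<le> \<Lambda>" "\<And>i. \<nu> i \<le> \<Lambda>"
  shows "loop_buffer f \<mu> \<Lambda> \<xi> \<nu> k =
    planned_buffer f \<mu> \<Lambda> (loop_state f \<mu> \<Lambda> \<xi> \<nu> k) (usable_before \<nu> (Suc k))"
proof (induction k)
  case 0
  show ?case using assms
    by (cases \<Lambda>)
      (auto simp: update_buffer_def planned_buffer_def next_count_def replicate_append_same)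
next
  case (Suc k)
  show ?case
    using update_planned_buffer[OF assms(1) usable_before_le[of \<nu> \<Lambda> "Suc k"], OF assms(2,2)] Suc
    by simp
qed

text \<open>This separates the two sources of randomness: the initial state enters only through \<open>V \<xi>\<close>, and the
  gain depends only on the computing resources.\<close>

lemma lyapunov_le_gain:
  assumes "1 \<le> \<Lambda>" "\<And>i. \<nu> i \<le> \<Lambda>" "0 \<le> \<rho>" "0 \<le> \<alpha>"
    and "\<And>z. V (f (z, \<mu> z, 0)) \<le> \<rho> * V z" "\<And>z. V (f (z, 0, 0)) \<le> \<alpha> * V z"
  shows "V (loop_state f \<mu> \<Lambda> \<xi> \<nu> k) \<le> V \<xi> * gain \<rho> \<alpha> \<nu> k"
proof (induction k)
  case 0
  show ?case by (simp add: gain_0)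
next
  case (Suc k)
  let ?z = "loop_state f \<mu> \<Lambda> \<xi> \<nu> k" and ?r = "rate \<rho> \<alpha> (usable_before \<nu> (Suc k))"
  have "V (loop_state f \<mu> \<Lambda> \<xi> \<nu> (Suc k)) \<le> ?r * V ?z"
    using assms(5,6) by (simp add: loop_buffer_eq_planned[OF assms(1,2)] hd_planned_buffer[OF assms(1)]
        rate_def)
  also have "\<dots> \<le> ?r * (V \<xi> * gain \<rho> \<alpha> \<nu> k)"
    by (intro mult_left_mono Suc rate_nonneg assms)
  finally show ?case by (simp add: gain_Suc mult_ac)
qed

section \<open>Expected total gain\<close>

text \<open>For \<open>j \<ge> 2\<close> the recursion \<open>t j = 1 + p 0 * \<rho> * t (j - 1)\<close> is linear with constant coefficients and
  gives \<open>t j\<close> as a constant plus a multiple of \<open>(p 0 * \<rho>) ^ (j - 1)\<close>, the source of the powers in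
  \<open>\<sigma>\<close>. The solution is \<open>h j = B * t j\<close>, where \<open>B = 1 + B * \<theta>\<close> sums the geometric series of
  restarts.\<close>

lemma potential_exists:
  fixes p :: "nat \<Rightarrow> real"
  assumes "0 \<le> \<rho>" "\<rho> < 1" "1 \<le> \<alpha>" "\<And>l. l \<le> \<Lambda> \<Longrightarrow> 0 \<le> p l" "(\<Sum>l\<le>\<Lambda>. p l) = 1"
    and "p 0 < 1" "p 0 * \<alpha> < 1"
    and \<sigma>: "\<sigma> = 1 / (1 - p 0 * \<rho>) *
           (\<rho> * (1 - p 0 * \<alpha>) + (\<alpha> - \<rho>) / (1 - p 0) * (\<Sum>l = 1..\<Lambda>. p l * (p 0 * \<rho>) ^ l))"
    and "p 0 * \<alpha> + (1 - p 0) * \<sigma> < 1"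
  shows "\<exists>h. (\<forall>j. 0 \<le> h j) \<and>
    (\<forall>j. h j = 1 + (\<Sum>l\<le>\<Lambda>. p l * (rate \<rho> \<alpha> (next_count j l) * h (next_count j l))))"
proof -
  define q where "q = p 0"
  define c where "c = q * (\<alpha> - \<rho>) / (1 - q * \<alpha>)"
  define t where "t j = (1 + c * (q * \<rho>) ^ (j - 1)) / (1 - q * \<rho>)" for j :: nat
  define S where "S = (\<Sum>l = 1..\<Lambda>. p l * (q * \<rho>) ^ l)"
  define \<theta> where "\<theta> = (\<Sum>l = 1..\<Lambda>. p l * (\<rho> * t l))"
  have split: "(\<Sum>l\<le>\<Lambda>. g l) = g 0 + (\<Sum>l = 1..\<Lambda>. g l)" for g :: "nat \<Rightarrow> real"
    by (simp add: atMost_atLeast0 sum.atLeast_Suc_atMost)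
  have q: "0 \<le> q" "q < 1" "q * \<alpha> < 1" using assms by (auto simp: q_def)
  have q\<rho>: "q * \<rho> < 1"
    using q assms(1,2) mult_left_mono[of \<rho> 1 q] by linarith
  have c: "0 \<le> c" using q assms by (simp add: c_def)
  have t_nonneg: "0 \<le> t j" for j
    using c q q\<rho> assms by (simp add: t_def)
  \<comment> \<open>The factor \<open>\<rho>\<close> of the step that computes the controls combines with the factor \<open>q\<close> in \<open>c\<close> to
    raise the exponent by one.\<close>
  have "\<rho> * c * (q * \<rho>) ^ (l - 1) = (\<alpha> - \<rho>) / (1 - q * \<alpha>) * (q * \<rho>) ^ l" if "1 \<le> l" for l
    using that by (cases l) (auto simp: c_def)
  then have "p l * (\<rho> * t l) = (\<rho> * p l + (\<alpha> - \<rho>) / (1 - q * \<alpha>) * (p l * (q * \<rho>) ^ l)) / (1 - q * \<rho>)"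
    if "1 \<le> l" for l
    using that by (simp add: t_def algebra_simps)
  then have "\<theta> = (\<Sum>l = 1..\<Lambda>. (\<rho> * p l + (\<alpha> - \<rho>) / (1 - q * \<alpha>) * (p l * (q * \<rho>) ^ l)) / (1 - q * \<rho>))"
    unfolding \<theta>_def by (intro sum.cong) auto
  also have "\<dots> = (\<rho> * (\<Sum>l = 1..\<Lambda>. p l) + (\<alpha> - \<rho>) / (1 - q * \<alpha>) * S) / (1 - q * \<rho>)"
    unfolding S_def sum_divide_distrib[symmetric] sum.distrib sum_distrib_left ..
  also have "(\<Sum>l = 1..\<Lambda>. p l) = 1 - q"
    using assms(5) split[of p] by (simp add: q_def)
  finally have \<theta>: "\<theta> = (\<rho> * (1 - q) + (\<alpha> - \<rho>) / (1 - q * \<alpha>) * S) / (1 - q * \<rho>)" .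
  have "(1 - q) * \<sigma> = (1 - q * \<alpha>) * \<theta>"
  proof -
    have "w * (1 / d * (\<rho> * e + a / w * S)) = e * ((\<rho> * w + a / e * S) / d)"
      if "w \<noteq> 0" "d \<noteq> 0" "e \<noteq> 0" for a d e w :: real
      using that by (simp add: field_simps)
    from this[of "1 - q" "1 - q * \<rho>" "1 - q * \<alpha>" "\<alpha> - \<rho>"] show ?thesis
      unfolding \<theta> \<sigma> q_def[symmetric] S_def[symmetric] using q q\<rho> by simp
  qed
  moreover have "(1 - q) * \<sigma> < (1 - q * \<alpha>) * 1"
    using assms(9) unfolding q_def[symmetric] by simp
  ultimately have "\<theta> < 1"
    using q by (simp only: mult_less_cancel_left_pos diff_gt_0_iff_gt)
  define B where "B = 1 / (1 - \<theta>)"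
  have B: "0 \<le> B" "B = 1 + B * \<theta>" using \<open>\<theta> < 1\<close> by (auto simp: B_def field_simps)
  have t_rec: "t j = 1 + q * (rate \<rho> \<alpha> (j - 1) * t (j - 1))" for j
  proof (cases "j \<le> 1")
    case True
    then have j: "j - 1 = 0" "t j = t 0" by (auto simp: t_def)
    have "1 + c = (1 - q * \<rho>) / (1 - q * \<alpha>)"
      using q by (simp add: c_def field_simps)
    then have "t 0 = 1 / (1 - q * \<alpha>)"
      using q\<rho> by (simp add: t_def)
    then have "t 0 = 1 + q * (rate \<rho> \<alpha> 0 * t 0)"
      using q by (simp add: rate_def field_simps)
    then show ?thesis unfolding j .
  next
    case False
    then obtain i where "j = Suc (Suc i)"
      by (metis One_nat_def Suc_le_mono le0 not0_implies_Suc)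
    then show ?thesis using q\<rho> by (simp add: t_def rate_def field_simps)
  qed
  have "B * t j = 1 + (\<Sum>l\<le>\<Lambda>. p l * (rate \<rho> \<alpha> (next_count j l) * (B * t (next_count j l))))" for j
  proof -
    have "(\<Sum>l = 1..\<Lambda>. p l * (rate \<rho> \<alpha> (next_count j l) * (B * t (next_count j l)))) = B * \<theta>"
      unfolding \<theta>_def sum_distrib_left by (intro sum.cong) (auto simp: next_count_def rate_def)
    then have "1 + (\<Sum>l\<le>\<Lambda>. p l * (rate \<rho> \<alpha> (next_count j l) * (B * t (next_count j l)))) =
        1 + B * \<theta> + B * (q * (rate \<rho> \<alpha> (j - 1) * t (j - 1)))"
      by (simp add: split next_count_def q_def)
    also have "\<dots> = B * (1 + q * (rate \<rho> \<alpha> (j - 1) * t (j - 1)))"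
      by (simp only: distrib_left mult_1_right B(2)[symmetric])
    finally show ?thesis unfolding t_rec[of j, symmetric] by (rule sym)
  qed
  with B(1) t_nonneg show ?thesis
    by (intro exI[of _ "\<lambda>j. B * t j"] conjI allI mult_nonneg_nonneg)
qed

lemma (in prob_space) nn_integral_indep_pair:
  assumes "indep_var S X T Y" and [measurable]: "g \<in> borel_measurable (S \<Otimes>\<^sub>M T)"
  shows "(\<integral>\<^sup>+\<omega>. g (X \<omega>, Y \<omega>) \<partial>M) = (\<integral>\<^sup>+\<omega>. \<integral>\<^sup>+\<omega>'. g (X \<omega>, Y \<omega>') \<partial>M \<partial>M)"
proof -
  have [measurable]: "X \<in> measurable M S" "Y \<in> measurable M T"
    using assms(1) by (auto dest: indep_var_rv1 indep_var_rv2)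
  interpret Y: prob_space "distr M T Y" by (rule prob_space_distr) measurable
  have "(\<integral>\<^sup>+\<omega>. g (X \<omega>, Y \<omega>) \<partial>M) = (\<integral>\<^sup>+z. g z \<partial>distr M (S \<Otimes>\<^sub>M T) (\<lambda>\<omega>. (X \<omega>, Y \<omega>)))"
    by (subst nn_integral_distr) auto
  also have "\<dots> = (\<integral>\<^sup>+z. g z \<partial>(distr M S X \<Otimes>\<^sub>M distr M T Y))"
    using assms(1) by (simp add: indep_var_distribution_eq)
  also have "\<dots> = (\<integral>\<^sup>+x. \<integral>\<^sup>+y. g (x, y) \<partial>distr M T Y \<partial>distr M S X)"
    by (subst Y.nn_integral_fst[symmetric]) auto
  also have "\<dots> = (\<integral>\<^sup>+\<omega>. \<integral>\<^sup>+\<omega>'. g (X \<omega>, Y \<omega>') \<partial>M \<partial>M)"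
  proof (subst nn_integral_distr)
    show "(\<integral>\<^sup>+\<omega>. \<integral>\<^sup>+y. g (X \<omega>, y) \<partial>distr M T Y \<partial>M) = (\<integral>\<^sup>+\<omega>. \<integral>\<^sup>+\<omega>'. g (X \<omega>, Y \<omega>') \<partial>M \<partial>M)"
    proof (intro nn_integral_cong)
      fix \<omega> assume "\<omega> \<in> space M"
      then have "X \<omega> \<in> space S" by (rule measurable_space[rotated]) measurable
      then show "(\<integral>\<^sup>+y. g (X \<omega>, y) \<partial>distr M T Y) = (\<integral>\<^sup>+\<omega>'. g (X \<omega>, Y \<omega>') \<partial>M)"
        by (intro nn_integral_distr measurable_Pair2[OF assms(2)]) measurable
    qed
  qed measurable
  finally show ?thesis .
qed

text \<open>\<open>indep_var\<close> asks both variables to have the same type. For a random vector and a random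
  sequence independence can therefore only be stated for the generated \<open>\<sigma>\<close>-algebras; composing
  with \<open>u\<close> and \<open>v\<close> leads back to two \<open>ennreal\<close>-valued variables.\<close>

lemma (in prob_space) nn_integral_indep_set_mult:
  fixes u v :: "_ \<Rightarrow> ennreal"
  assumes indep: "indep_set (sets (vimage_algebra (space M) X S)) (sets (vimage_algebra (space M) Y T))"
    and [measurable]: "X \<in> measurable M S" "Y \<in> measurable M T"
      "u \<in> borel_measurable S" "v \<in> borel_measurable T"
  shows "(\<integral>\<^sup>+\<omega>. u (X \<omega>) * v (Y \<omega>) \<partial>M) = (\<integral>\<^sup>+\<omega>. u (X \<omega>) \<partial>M) * (\<integral>\<^sup>+\<omega>. v (Y \<omega>) \<partial>M)"
proof -
  have generated: "sigma_sets (space M) {(\<lambda>\<omega>. w (Z \<omega>)) -` A \<inter> space M | A. A \<in> sets borel}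
      \<subseteq> sets (vimage_algebra (space M) Z R)"
    if "Z \<in> measurable M R" "w \<in> borel_measurable R" for Z R and w :: "_ \<Rightarrow> ennreal"
  proof -
    have "Z \<in> measurable (vimage_algebra (space M) Z R) R"
      using that(1) by (intro measurable_vimage_algebra1) (auto dest: measurable_space)
    then have "(\<lambda>\<omega>. w (Z \<omega>)) \<in> borel_measurable (vimage_algebra (space M) Z R)"
      using that(2) by (rule measurable_compose)
    then show ?thesis
      by (intro sets.sigma_sets_subset[of _ "vimage_algebra (space M) Z R", simplified])
        (auto dest: measurable_sets)
  qed
  have "indep_var borel (\<lambda>\<omega>. u (X \<omega>)) borel (\<lambda>\<omega>. v (Y \<omega>))"
    unfolding indep_var_eq
  proof (intro conjI)
    show "indep_set (sigma_sets (space M) {(\<lambda>\<omega>. u (X \<omega>)) -` A \<inter> space M | A. A \<in> sets borel})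
        (sigma_sets (space M) {(\<lambda>\<omega>. v (Y \<omega>)) -` A \<inter> space M | A. A \<in> sets borel})"
      using indep unfolding indep_set_def
    proof (rule indep_sets_mono_sets)
      fix i :: bool
      show "(case i of True \<Rightarrow> sigma_sets (space M) {(\<lambda>\<omega>. u (X \<omega>)) -` A \<inter> space M | A. A \<in> sets borel}
            | False \<Rightarrow> sigma_sets (space M) {(\<lambda>\<omega>. v (Y \<omega>)) -` A \<inter> space M | A. A \<in> sets borel})
          \<subseteq> (case i of True \<Rightarrow> sets (vimage_algebra (space M) X S)
            | False \<Rightarrow> sets (vimage_algebra (space M) Y T))"
        by (cases i) (simp_all only: bool.case generated[OF assms(2,4)] generated[OF assms(3,5)])
    qed
  qed measurable
  from nn_integral_indep_pair[OF this, of "\<lambda>z. fst z * snd z"]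
  show ?thesis
    by (simp add: nn_integral_cmult nn_integral_multc)
qed

lemma (in prob_space) nn_integral_finite_range:
  fixes Y :: "'a \<Rightarrow> nat" and G :: "nat \<Rightarrow> ennreal"
  assumes [measurable]: "Y \<in> measurable M (count_space UNIV)"
    and "\<And>\<omega>. \<omega> \<in> space M \<Longrightarrow> Y \<omega> \<le> \<Lambda>"
  shows "(\<integral>\<^sup>+\<omega>. G (Y \<omega>) \<partial>M) = (\<Sum>l\<le>\<Lambda>. ennreal (prob {\<omega> \<in> space M. Y \<omega> = l}) * G l)"
proof -
  have "(\<integral>\<^sup>+\<omega>. G (Y \<omega>) \<partial>M) =
      (\<integral>\<^sup>+\<omega>. (\<Sum>l\<le>\<Lambda>. G l * indicator {\<omega> \<in> space M. Y \<omega> = l} \<omega>) \<partial>M)"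
  proof (intro nn_integral_cong)
    fix \<omega> assume \<omega>: "\<omega> \<in> space M"
    then have "(\<Sum>l\<le>\<Lambda>. G l * indicator {\<omega> \<in> space M. Y \<omega> = l} \<omega>) = (\<Sum>l\<le>\<Lambda>. if Y \<omega> = l then G l else 0)"
      by (intro sum.cong) auto
    then show "G (Y \<omega>) = (\<Sum>l\<le>\<Lambda>. G l * indicator {\<omega> \<in> space M. Y \<omega> = l} \<omega>)"
      using assms(2)[OF \<omega>] by simp
  qed
  also have "\<dots> = (\<Sum>l\<le>\<Lambda>. G l * emeasure M {\<omega> \<in> space M. Y \<omega> = l})"
    by (subst nn_integral_sum) (auto intro!: sum.cong nn_integral_cmult_indicator)
  finally show ?thesis by (simp add: emeasure_eq_measure mult.commute)
qed

lemma measurable_usable_before: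
  "{..<k} \<subseteq> I \<Longrightarrow> (\<lambda>\<nu>. usable_before \<nu> k) \<in> measurable (Pi\<^sub>M I (\<lambda>_. count_space UNIV)) (count_space UNIV)"
proof (induction k)
  case (Suc k)
  have "(\<lambda>\<nu>. \<nu> k) \<in> measurable (Pi\<^sub>M I (\<lambda>_. count_space UNIV)) (count_space UNIV)"
    using Suc.prems by (intro measurable_component_singleton) auto
  then have "(\<lambda>\<nu>. next_count j (\<nu> k)) \<in> measurable (Pi\<^sub>M I (\<lambda>_. count_space UNIV)) (count_space UNIV)" for j
    by (rule measurable_compose) simp
  moreover have "(\<lambda>\<nu>. usable_before \<nu> k) \<in> measurable (Pi\<^sub>M I (\<lambda>_. count_space UNIV)) (count_space UNIV)"
    using Suc.prems by (intro Suc.IH) auto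
  ultimately show ?case
    unfolding usable_before.simps
    by (rule measurable_compose_countable[where f = "\<lambda>j \<nu>. next_count j (\<nu> k)"])
qed simp

lemma measurable_gain:
  assumes "{..<k} \<subseteq> I"
  shows "(\<lambda>\<nu>. gain \<rho> \<alpha> \<nu> k) \<in> borel_measurable (Pi\<^sub>M I (\<lambda>_. count_space UNIV))"
  unfolding gain_def
proof (rule borel_measurable_prod)
  fix i assume "i \<in> {..<k}"
  then have "(\<lambda>\<nu>. usable_before \<nu> (Suc i)) \<in> measurable (Pi\<^sub>M I (\<lambda>_. count_space UNIV)) (count_space UNIV)"
    using assms by (intro measurable_usable_before) auto
  then show "(\<lambda>\<nu>. rate \<rho> \<alpha> (usable_before \<nu> (Suc i))) \<in> borel_measurable (Pi\<^sub>M I (\<lambda>_. count_space UNIV))"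
    by (rule measurable_compose) simp
qed

text \<open>The conditional expectation given the past of the Markov chain, in integrated form: the gain and
  the count before step \<open>k\<close> are functions of \<open>N 0, \<dots>, N (k - 1)\<close>, hence independent of \<open>N k\<close>.\<close>

lemma (in prob_space) nn_integral_next_step:
  fixes N :: "nat \<Rightarrow> 'a \<Rightarrow> nat" and h :: "nat \<Rightarrow> real"
  assumes indep: "indep_vars (\<lambda>_. count_space UNIV) N UNIV"
    and le: "\<And>k \<omega>. \<omega> \<in> space M \<Longrightarrow> N k \<omega> \<le> \<Lambda>"
    and p: "\<And>k l. l \<le> \<Lambda> \<Longrightarrow> prob {\<omega> \<in> space M. N k \<omega> = l} = p l"
    and h: "\<And>j. 0 \<le> h j"
    and rates: "0 \<le> \<rho>" "0 \<le> \<alpha>"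
  shows "(\<integral>\<^sup>+\<omega>. ennreal (gain \<rho> \<alpha> (\<lambda>i. N i \<omega>) (Suc k) * h (usable_before (\<lambda>i. N i \<omega>) (Suc k))) \<partial>M) =
    (\<integral>\<^sup>+\<omega>. ennreal (gain \<rho> \<alpha> (\<lambda>i. N i \<omega>) k *
      (\<Sum>l\<le>\<Lambda>. p l * (rate \<rho> \<alpha> (next_count (usable_before (\<lambda>i. N i \<omega>) k) l) *
         h (next_count (usable_before (\<lambda>i. N i \<omega>) k) l)))) \<partial>M)"
proof -
  let ?S = "Pi\<^sub>M {..<k} (\<lambda>_. count_space UNIV :: nat measure)"
  let ?T = "Pi\<^sub>M {k} (\<lambda>_. count_space UNIV :: nat measure)"
  let ?past = "\<lambda>\<omega>. restrict (\<lambda>i. N i \<omega>) {..<k}"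
  let ?now = "\<lambda>\<omega>. restrict (\<lambda>i. N i \<omega>) {k}"
  define r where "r j l = rate \<rho> \<alpha> (next_count j l) * h (next_count j l)" for j l
  define g where "g = (\<lambda>(\<nu>, \<nu>'). ennreal (gain \<rho> \<alpha> \<nu> k * r (usable_before \<nu> k) (\<nu>' k)))"
  have r: "0 \<le> r j l" for j l by (simp add: r_def h rate_nonneg rates)
  have pos: "0 \<le> p l" if "l \<le> \<Lambda>" for l using p[OF that, of 0, symmetric] by simp
  have past: "gain \<rho> \<alpha> (?past \<omega>) k = gain \<rho> \<alpha> (\<lambda>i. N i \<omega>) k"
    "usable_before (?past \<omega>) k = usable_before (\<lambda>i. N i \<omega>) k" for \<omega>
    by (auto intro: gain_cong usable_before_cong)
  have ind: "indep_var ?S ?past ?T ?now"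
    by (rule indep_var_restrict[OF indep]) auto
  have [measurable]: "(\<lambda>\<nu>. gain \<rho> \<alpha> \<nu> k) \<in> borel_measurable ?S"
    "(\<lambda>\<nu>. usable_before \<nu> k) \<in> measurable ?S (count_space UNIV)"
    "(\<lambda>\<nu>. \<nu> k) \<in> measurable ?T (count_space UNIV)"
    by (auto intro: measurable_gain measurable_usable_before measurable_component_singleton)
  have g: "g \<in> borel_measurable (?S \<Otimes>\<^sub>M ?T)"
    unfolding g_def by measurable
  have N: "N k \<in> measurable M (count_space UNIV)"
    using indep by (auto simp: indep_vars_def)
  have "(\<integral>\<^sup>+\<omega>. ennreal (gain \<rho> \<alpha> (\<lambda>i. N i \<omega>) (Suc k) * h (usable_before (\<lambda>i. N i \<omega>) (Suc k))) \<partial>M)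
      = (\<integral>\<^sup>+\<omega>. g (?past \<omega>, ?now \<omega>) \<partial>M)"
    by (simp add: g_def r_def past gain_Suc mult.assoc)
  also have "\<dots> = (\<integral>\<^sup>+\<omega>. \<integral>\<^sup>+\<omega>'. g (?past \<omega>, ?now \<omega>') \<partial>M \<partial>M)"
    by (rule nn_integral_indep_pair[OF ind g])
  also have "\<dots> = (\<integral>\<^sup>+\<omega>. (\<Sum>l\<le>\<Lambda>. ennreal (p l) *
      ennreal (gain \<rho> \<alpha> (\<lambda>i. N i \<omega>) k * r (usable_before (\<lambda>i. N i \<omega>) k) l)) \<partial>M)"
    using nn_integral_finite_range[OF N le, where G = "\<lambda>l. ennreal (gain \<rho> \<alpha> (\<lambda>i. N i \<omega>) k *
      r (usable_before (\<lambda>i. N i \<omega>) k) l)" for \<omega>]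
    by (simp add: g_def past p)
  also have "\<dots> = (\<integral>\<^sup>+\<omega>. ennreal (gain \<rho> \<alpha> (\<lambda>i. N i \<omega>) k *
      (\<Sum>l\<le>\<Lambda>. p l * r (usable_before (\<lambda>i. N i \<omega>) k) l)) \<partial>M)"
  proof (intro nn_integral_cong)
    fix \<omega>
    let ?g = "gain \<rho> \<alpha> (\<lambda>i. N i \<omega>) k" and ?j = "usable_before (\<lambda>i. N i \<omega>) k"
    have "(\<Sum>l\<le>\<Lambda>. ennreal (p l) * ennreal (?g * r ?j l)) = (\<Sum>l\<le>\<Lambda>. ennreal (?g * (p l * r ?j l)))"
      using pos r gain_nonneg[OF rates]
      by (intro sum.cong) (auto simp: ennreal_mult[symmetric] mult_ac)
    also have "\<dots> = ennreal (\<Sum>l\<le>\<Lambda>. ?g * (p l * r ?j l))"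
      using pos r gain_nonneg[OF rates] by (intro sum_ennreal) auto
    finally show "(\<Sum>l\<le>\<Lambda>. ennreal (p l) * ennreal (?g * r ?j l)) = ennreal (?g * (\<Sum>l\<le>\<Lambda>. p l * r ?j l))"
      by (simp add: sum_distrib_left)
  qed
  finally show ?thesis by (simp add: r_def)
qed

text \<open>Integrating the equation for \<open>h\<close> against the gain at \<open>k\<close> turns it into a telescoping identity
  for the quantities \<open>H k\<close>, starting from \<open>H 0 = h 0\<close>.\<close>

lemma (in prob_space) expected_total_gain_le:
  fixes N :: "nat \<Rightarrow> 'a \<Rightarrow> nat" and h :: "nat \<Rightarrow> real"
  assumes indep: "indep_vars (\<lambda>_. count_space UNIV) N UNIV"
    and le: "\<And>k \<omega>. \<omega> \<in> space M \<Longrightarrow> N k \<omega> \<le> \<Lambda>"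
    and p: "\<And>k l. l \<le> \<Lambda> \<Longrightarrow> prob {\<omega> \<in> space M. N k \<omega> = l} = p l"
    and h: "\<And>j. 0 \<le> h j"
      "\<And>j. h j = 1 + (\<Sum>l\<le>\<Lambda>. p l * (rate \<rho> \<alpha> (next_count j l) * h (next_count j l)))"
    and rates: "0 \<le> \<rho>" "0 \<le> \<alpha>"
  shows "(\<Sum>k. \<integral>\<^sup>+\<omega>. ennreal (gain \<rho> \<alpha> (\<lambda>i. N i \<omega>) k) \<partial>M) \<le> ennreal (h 0)"
proof -
  let ?g = "\<lambda>k \<omega>. gain \<rho> \<alpha> (\<lambda>i. N i \<omega>) k"
  let ?j = "\<lambda>k \<omega>. usable_before (\<lambda>i. N i \<omega>) k"
  define H where "H k = (\<integral>\<^sup>+\<omega>. ennreal (?g k \<omega> * h (?j k \<omega>)) \<partial>M)" for k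
  have rv: "(\<lambda>\<omega> i. N i \<omega>) \<in> measurable M (Pi\<^sub>M UNIV (\<lambda>_. count_space UNIV))"
    using indep by (intro measurable_PiM_single') (auto simp: indep_vars_def)
  have [measurable]: "?g k \<in> borel_measurable M" "?j k \<in> measurable M (count_space UNIV)" for k
    by (auto intro: measurable_compose[OF rv measurable_gain] measurable_compose[OF rv measurable_usable_before])
  have step: "(\<integral>\<^sup>+\<omega>. ennreal (?g k \<omega>) \<partial>M) + H (Suc k) = H k" for k
  proof -
    let ?s = "\<lambda>\<omega>. \<Sum>l\<le>\<Lambda>. p l * (rate \<rho> \<alpha> (next_count (?j k \<omega>) l) * h (next_count (?j k \<omega>) l))"
    have pos: "0 \<le> p l" if "l \<le> \<Lambda>" for l using p[OF that, of 0, symmetric] by simp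
    have s: "0 \<le> ?s \<omega>" for \<omega>
      using pos by (intro sum_nonneg mult_nonneg_nonneg rate_nonneg rates h(1)) auto
    have "(\<integral>\<^sup>+\<omega>. ennreal (?g k \<omega>) \<partial>M) + H (Suc k) =
        (\<integral>\<^sup>+\<omega>. ennreal (?g k \<omega>) \<partial>M) + (\<integral>\<^sup>+\<omega>. ennreal (?g k \<omega> * ?s \<omega>) \<partial>M)"
      unfolding H_def
      by (subst nn_integral_next_step[OF indep le p h(1) rates]) (assumption | rule refl)+
    also have "\<dots> = (\<integral>\<^sup>+\<omega>. ennreal (?g k \<omega>) + ennreal (?g k \<omega> * ?s \<omega>) \<partial>M)"
      by (rule nn_integral_add[symmetric]) measurable
    also have "\<dots> = H k"
      unfolding H_def
    proof (intro nn_integral_cong)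
      fix \<omega>
      have "?g k \<omega> * h (?j k \<omega>) = ?g k \<omega> + ?g k \<omega> * ?s \<omega>"
        using h(2)[of "?j k \<omega>"] by (simp add: distrib_left)
      then show "ennreal (?g k \<omega>) + ennreal (?g k \<omega> * ?s \<omega>) = ennreal (?g k \<omega> * h (?j k \<omega>))"
        using s[of \<omega>] gain_nonneg[OF rates] by (simp add: ennreal_plus[symmetric] del: ennreal_plus)
    qed
    finally show ?thesis .
  qed
  have partial: "(\<Sum>k<n. \<integral>\<^sup>+\<omega>. ennreal (?g k \<omega>) \<partial>M) + H n = H 0" for n
  proof (induction n)
    case (Suc n)
    then show ?case using step[of n] by (simp add: add.assoc)
  qed simp
  have "H 0 = ennreal (h 0)" by (simp add: H_def gain_0 emeasure_space_1)
  then have "(\<Sum>k<n. \<integral>\<^sup>+\<omega>. ennreal (?g k \<omega>) \<partial>M) \<le> ennreal (h 0)" for n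
    using partial[of n] by (metis add.right_neutral add_left_mono zero_le)
  then show ?thesis by (intro suminf_le_const) auto
qed

section \<open>Stochastic stability\<close>

theorem theorem2:
  fixes M :: "'w measure"
    and f :: "(real^'n) \<times> (real^'p) \<times> (real^'m) \<Rightarrow> real^'n"
    and V :: "real^'n \<Rightarrow> real"
    and \<kappa> \<mu> :: "real^'n \<Rightarrow> real^'p"
    and \<phi>1 \<phi>2 :: "real \<Rightarrow> real"
    and \<rho> \<alpha> \<sigma> :: real
    and \<Lambda> :: nat
    and N :: "nat \<Rightarrow> 'w \<Rightarrow> nat"
    and p :: "nat \<Rightarrow> real"
    and x0 :: "'w \<Rightarrow> real^'n"
    and x :: "nat \<Rightarrow> 'w \<Rightarrow> real^'n"
    and P :: "'w measure"
  assumes "prob_space M"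
    and "f \<in> borel_measurable borel" "V \<in> borel_measurable borel"
      "\<kappa> \<in> borel_measurable borel" "\<mu> \<in> borel_measurable borel"
    and "f (0, 0, 0) = 0"
    and "1 \<le> \<Lambda>"
    and "class_K_infinity \<phi>1" "class_K_infinity \<phi>2"
    and "0 \<le> \<rho>" "\<rho> < 1"
    and "\<And>z. 0 \<le> V z"
    and "\<And>z. \<phi>1 (norm z) \<le> V z" "\<And>z. V z \<le> \<phi>2 (norm z)"
    and "\<And>z. V (f (z, \<kappa> z, 0)) \<le> \<rho> * V z"
    and "\<And>z. V (f (z, \<mu> z, 0)) \<le> \<rho> * V z"
    and "\<And>k \<omega>. \<omega> \<in> space M \<Longrightarrow> N k \<omega> \<in> {0..\<Lambda>}"
    and "prob_space.indep_vars M (\<lambda>_. count_space UNIV) N UNIV"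
    and "\<And>k l. l \<in> {0..\<Lambda>} \<Longrightarrow> measure M {\<omega> \<in> space M. N k \<omega> = l} = p l"
    and "0 \<le> p 0" "p 0 < 1"
    and "x0 \<in> borel_measurable M"
    and "prob_space.indep_set M
           (sets (vimage_algebra (space M) x0 borel))
           (sets (vimage_algebra (space M) (\<lambda>\<omega> k. N k \<omega>) (Pi\<^sub>M UNIV (\<lambda>_. count_space UNIV))))"
    and "P = uniform_measure M {\<omega> \<in> space M. N 0 \<omega> > 0}"
    and "1 \<le> \<alpha>" "ereal \<alpha> < 1 / ereal (p 0)"
    and "\<And>z. V (f (z, 0, 0)) \<le> \<alpha> * V z"
    and "(\<integral>\<^sup>+\<omega>. ennreal (\<phi>2 (norm (x0 \<omega>))) \<partial>P) < \<infinity>"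
    and "x = (\<lambda>k \<omega>. loop_state f \<mu> \<Lambda> (x0 \<omega>) (\<lambda>i. N i \<omega>) k)"
    and "\<sigma> = 1 / (1 - p 0 * \<rho>) *
           (\<rho> * (1 - p 0 * \<alpha>) + (\<alpha> - \<rho>) / (1 - p 0) * (\<Sum>l = 1..\<Lambda>. p l * (p 0 * \<rho>) ^ l))"
    and "p 0 * \<alpha> + (1 - p 0) * \<sigma> < 1"
  shows "stochastically_stable P x"
proof -
  interpret prob_space M by fact
  define A where "A = {\<omega> \<in> space M. N 0 \<omega> > 0}"
  let ?\<nu> = "\<lambda>\<omega> i. N i \<omega>"
  let ?seq = "Pi\<^sub>M UNIV (\<lambda>_. count_space UNIV) :: (nat \<Rightarrow> nat) measure"
  have N_le: "N k \<omega> \<le> \<Lambda>" if "\<omega> \<in> space M" for k \<omega>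
    using assms(17)[OF that] by simp
  have p: "prob {\<omega> \<in> space M. N k \<omega> = l} = p l" if "l \<le> \<Lambda>" for k l
    using assms(19) that by simp
  have N[measurable]: "N k \<in> measurable M (count_space UNIV)" for k
    using assms(18) by (auto simp: indep_vars_def)
  have rv: "?\<nu> \<in> measurable M ?seq"
    by (intro measurable_PiM_single') auto
  have x0[measurable]: "x0 \<in> borel_measurable M" by fact
  have V[measurable]: "V \<in> borel_measurable borel" by fact
  have rates: "0 \<le> \<rho>" "0 \<le> \<alpha>" using assms by auto
  have gain_meas: "(\<lambda>\<nu>. gain \<rho> \<alpha> \<nu> k) \<in> borel_measurable ?seq" for k
    by (rule measurable_gain) simp
  have [measurable]: "(\<lambda>\<omega>. gain \<rho> \<alpha> (?\<nu> \<omega>) k) \<in> borel_measurable M" for k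
    by (rule measurable_compose[OF rv gain_meas])
  note indep_mult = nn_integral_indep_set_mult[OF assms(23) x0 rv]
  have p_nonneg: "0 \<le> p l" if "l \<le> \<Lambda>" for l
    using p[OF that, of 0] measure_nonneg[of M] by metis
  have "ennreal (\<Sum>l\<le>\<Lambda>. p l) = (\<Sum>l\<le>\<Lambda>. ennreal (p l) * 1)"
    using p_nonneg by (subst sum_ennreal[symmetric]) auto
  also have "\<dots> = (\<integral>\<^sup>+\<omega>. 1 \<partial>M)"
    by (subst nn_integral_finite_range[OF N N_le, of "\<lambda>_. 1" 0]) (auto simp: p)
  finally have sum_p: "(\<Sum>l\<le>\<Lambda>. p l) = 1"
    by (simp add: emeasure_space_1)
  have "p 0 * \<alpha> < 1"
  proof (cases "p 0 = 0")
    case False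
    then have "\<alpha> < 1 / p 0" using assms(20,26) by (simp add: one_ereal_def)
    then show ?thesis using False assms(20) by (simp add: field_simps)
  qed simp
  have "\<exists>h. (\<forall>j. 0 \<le> h j) \<and>
      (\<forall>j. h j = 1 + (\<Sum>l\<le>\<Lambda>. p l * (rate \<rho> \<alpha> (next_count j l) * h (next_count j l))))"
    by (rule potential_exists[OF assms(10,11,25) p_nonneg sum_p assms(21) \<open>p 0 * \<alpha> < 1\<close> assms(30,31)])
  then obtain h where h: "\<And>j. 0 \<le> h j"
      "\<And>j. h j = 1 + (\<Sum>l\<le>\<Lambda>. p l * (rate \<rho> \<alpha> (next_count j l) * h (next_count j l)))"
    by blast
  have total: "(\<Sum>k. \<integral>\<^sup>+\<omega>. ennreal (gain \<rho> \<alpha> (?\<nu> \<omega>) k) \<partial>M) \<le> ennreal (h 0)"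
    by (rule expected_total_gain_le[OF assms(18) N_le p h rates])

  have A[measurable]: "A \<in> sets M" unfolding A_def by measurable
  have "prob A = 1 - p 0"
  proof -
    have "A = space M - {\<omega> \<in> space M. N 0 \<omega> = 0}" by (auto simp: A_def)
    then show ?thesis using p[of 0 0] by (simp add: prob_compl)
  qed
  then have eA: "emeasure M A = ennreal (1 - p 0)" by (simp add: emeasure_eq_measure)
  have P_int: "(\<integral>\<^sup>+\<omega>. u \<omega> \<partial>P) = (\<integral>\<^sup>+\<omega>. u \<omega> * indicator A \<omega> \<partial>M) / emeasure M A"
    if "u \<in> borel_measurable M" for u
    unfolding assms(24) A_def[symmetric] by (rule nn_integral_uniform_measure[OF that A])
  have A_seq: "indicator A \<omega> = (indicator {\<nu>. \<nu> 0 > 0} (?\<nu> \<omega>) :: ennreal)" if "\<omega> \<in> space M" for \<omega>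
    using that by (simp add: A_def indicator_def)
  have component: "(\<lambda>\<nu>. \<nu> 0) \<in> measurable ?seq (count_space UNIV)"
    by (rule measurable_component_singleton) simp
  have ind_meas[measurable]: "(\<lambda>\<nu>. indicator {\<nu>. \<nu> 0 > 0} \<nu> :: ennreal) \<in> borel_measurable ?seq"
    using measurable_compose[OF component, of "\<lambda>l. indicator {0<..} l :: ennreal" borel]
    by (simp add: indicator_def)
  have indA: "(\<integral>\<^sup>+\<omega>. indicator {\<nu>. \<nu> 0 > 0} (?\<nu> \<omega>) \<partial>M) = emeasure M A"
    unfolding nn_integral_indicator[OF A, symmetric] by (rule nn_integral_cong) (simp add: A_seq)

  define E where "E = (\<integral>\<^sup>+\<omega>. ennreal (V (x0 \<omega>)) \<partial>M)"
  \<comment> \<open>The hypothesis bounds the initial expectation only conditionally on \<open>N 0 > 0\<close>; since that event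
    is independent of \<open>x0\<close> and has positive probability, the unconditional one is finite too.\<close>
  have "E * emeasure M A / emeasure M A \<le> (\<integral>\<^sup>+\<omega>. ennreal (\<phi>2 (norm (x0 \<omega>))) \<partial>P)"
  proof -
    have "E * emeasure M A = (\<integral>\<^sup>+\<omega>. ennreal (V (x0 \<omega>)) * indicator {\<nu>. \<nu> 0 > 0} (?\<nu> \<omega>) \<partial>M)"
      unfolding E_def indA[symmetric]
      by (rule indep_mult[symmetric]) measurable
    also have "\<dots> = (\<integral>\<^sup>+\<omega>. ennreal (V (x0 \<omega>)) * indicator A \<omega> \<partial>M)"
      using A_seq by (intro nn_integral_cong) simp
    finally have "E * emeasure M A / emeasure M A = (\<integral>\<^sup>+\<omega>. ennreal (V (x0 \<omega>)) \<partial>P)"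
      by (subst P_int) auto
    also have "\<dots> \<le> (\<integral>\<^sup>+\<omega>. ennreal (\<phi>2 (norm (x0 \<omega>))) \<partial>P)"
      by (intro nn_integral_mono ennreal_leI assms(14))
    finally show ?thesis .
  qed
  also have "\<dots> < \<infinity>" by fact
  finally have E_fin: "E < \<infinity>"
    using assms(21) by (simp add: eA ennreal_mult_divide_eq)

  have bound: "(\<integral>\<^sup>+\<omega>. ennreal (\<phi>1 (norm (x k \<omega>))) \<partial>P) \<le>
      E / emeasure M A * (\<integral>\<^sup>+\<omega>. ennreal (gain \<rho> \<alpha> (?\<nu> \<omega>) k) \<partial>M)" for k
  proof -
    have "(\<integral>\<^sup>+\<omega>. ennreal (\<phi>1 (norm (x k \<omega>))) \<partial>P) \<le>
        (\<integral>\<^sup>+\<omega>. ennreal (V (x0 \<omega>)) * ennreal (gain \<rho> \<alpha> (?\<nu> \<omega>) k) \<partial>P)"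
    proof (rule nn_integral_mono)
      fix \<omega> assume "\<omega> \<in> space P"
      then have \<omega>: "\<omega> \<in> space M" using assms(24) by simp
      have "\<phi>1 (norm (x k \<omega>)) \<le> V (x k \<omega>)" by fact
      also have "\<dots> \<le> V (x0 \<omega>) * gain \<rho> \<alpha> (?\<nu> \<omega>) k"
        unfolding assms(29) using assms(7,16,27) N_le[OF \<omega>] rates
        by (intro lyapunov_le_gain) auto
      finally show "ennreal (\<phi>1 (norm (x k \<omega>))) \<le> ennreal (V (x0 \<omega>)) * ennreal (gain \<rho> \<alpha> (?\<nu> \<omega>) k)"
        using assms(12) gain_nonneg[OF rates] by (simp add: ennreal_mult[symmetric] ennreal_leI)
    qed
    also have "\<dots> = (\<integral>\<^sup>+\<omega>. ennreal (V (x0 \<omega>)) * ennreal (gain \<rho> \<alpha> (?\<nu> \<omega>) k) * indicator A \<omega> \<partial>M)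
        / emeasure M A"
      by (rule P_int) measurable
    \<comment> \<open>Dropping the indicator costs only the constant factor \<open>1 / (1 - p 0)\<close>, and the total gain is
      finite without conditioning.\<close>
    also have "\<dots> \<le> (\<integral>\<^sup>+\<omega>. ennreal (V (x0 \<omega>)) * ennreal (gain \<rho> \<alpha> (?\<nu> \<omega>) k) \<partial>M) / emeasure M A"
      by (intro divide_right_mono_ennreal nn_integral_mono) (auto simp: indicator_def)
    also have "(\<integral>\<^sup>+\<omega>. ennreal (V (x0 \<omega>)) * ennreal (gain \<rho> \<alpha> (?\<nu> \<omega>) k) \<partial>M) =
        E * (\<integral>\<^sup>+\<omega>. ennreal (gain \<rho> \<alpha> (?\<nu> \<omega>) k) \<partial>M)"
      unfolding E_def
      using gain_meas by (intro indep_mult) measurable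
    finally show ?thesis
      by (simp add: divide_ennreal_def mult_ac)
  qed
  have "(\<Sum>k. \<integral>\<^sup>+\<omega>. ennreal (\<phi>1 (norm (x k \<omega>))) \<partial>P) \<le>
      (\<Sum>k. E / emeasure M A * (\<integral>\<^sup>+\<omega>. ennreal (gain \<rho> \<alpha> (?\<nu> \<omega>) k) \<partial>M))"
    by (intro suminf_le bound) auto
  also have "\<dots> = E / emeasure M A * (\<Sum>k. \<integral>\<^sup>+\<omega>. ennreal (gain \<rho> \<alpha> (?\<nu> \<omega>) k) \<partial>M)"
    by (rule ennreal_suminf_cmult)
  also have "\<dots> \<le> E / emeasure M A * ennreal (h 0)"
    by (intro mult_left_mono total) simp
  also have "\<dots> < \<infinity>"
    using E_fin assms(21) by (simp add: eA ennreal_mult_eq_top_iff ennreal_divide_eq_top_iff less_top[symmetric])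
  finally show ?thesis
    unfolding stochastically_stable_def using assms(8) by blast
qed

end
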